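(* Let $n\ge2$ and let $(x_k)_{k\in\mathbb{Z}}$ be the stationary iterates of SGDM with stepsize $\gamma>0$ and momentum $\alpha\in[0,1)$ under the zero-th order noise model with the shuffle-once (SO) sampling scheme (defined in the context), and assume $(1+\alpha)\mathrm{Id}-\gamma A\succeq0$. Then for every $k$ $$\mathrm{Tr}[\mathrm{Var}(x_k)]=\frac{\gamma^2}{n-1}\sum_{i=1}^d(u_i^\top\Sigma u_i)\sum_{k'=1}^{n-1}\left|e^{-\frac{4\pi \mathrm{i}k'}{n}}-e^{-\frac{2\pi \mathrm{i}k'}{n}}(1+\alpha-\gamma\lambda_i)+\alpha\right|^{-2},$$ where $\mathrm{i}$ in the exponents is the imaginary unit.
   Context: Let $A_1,\dots,A_n\in\mathbb{R}^{d\times d}$ be symmetric and $b_1,\dots,b_n\in\mathbb{R}^d$; put $A=\frac1n\sum_i A_i$, assumed symmetric positive definite, $b=\frac1n\sum_i b_i$, $x^\star=-A^{-1}b$, $y_i=-A_iA^{-1}b+b_i$ (so $\sum_i y_i=0$), $\Sigma=\frac1n\sum_{i=1}^n y_iy_i^\top$. Let $(u_i)_{i=1}^d$ be an orthonormal basis of eigenvectors of $A$, $Au_i=\lambda_iu_i$, $\lambda_i>0$. Zero-th order noise model: the gradient of $f_i(x)=\frac12x^\top A_ix+b_i^\top x$ is replaced by $\widehat{\nabla f_i}(x)=Ax+y_i+b$. SGDM: $x_{k+1}=x_k+\alpha(x_k-x_{k-1})-\gamma\widehat{\nabla f_{i_k}}(x_k)$; equivalently, with $\Delta x_k=x_k-x^\star$,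 $\Delta x_{k+1}=((1+\alpha)\mathrm{Id}-\gamma A)\Delta x_k-\alpha\Delta x_{k-1}-\gamma y_{i_k}$. Shuffle-once: $(i_0,\dots,i_{n-1})$ is a uniformly random permutation of $\{1,\dots,n\}$ and $i_{k+n}=i_k$ for all $k\in\mathbb{Z}$ (variances are over the random permutation). Stationary iterates: $\Delta x_k=\sum_{j\in\mathbb{Z}}H_{k-j}y_{i_j}$, where $(H_k)_{k\in\mathbb{Z}}$ are the matrices with $\sum_kH_kz^{-k}=H(z):=-\gamma z(z^2\mathrm{Id}-z((1+\alpha)\mathrm{Id}-\gamma A)+\alpha\mathrm{Id})^{-1}$ for $|z|=1$. *)

theory Defs
  imports
    "HOL-Analysis.Analysis"
    "HOL-Probability.Probability"
    "HOL-Combinatorics.Multiset_Permutations"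
begin

section \<open>Linear algebra\<close>

definition outer :: "real^'d \<Rightarrow> real^'d \<Rightarrow> real^'d^'d" where
  "outer v w = (\<chi> i j. v $ i * w $ j)"

definition symmetric_matrix :: "real^'d^'d \<Rightarrow> bool" where
  "symmetric_matrix M \<longleftrightarrow> transpose M = M"

definition pos_def :: "real^'d^'d \<Rightarrow> bool" where
  "pos_def M \<longleftrightarrow> symmetric_matrix M \<and> (\<forall>v. v \<noteq> 0 \<longrightarrow> v \<bullet> (M *v v) > 0)"

definition pos_semidef :: "real^'d^'d \<Rightarrow> bool" where
  "pos_semidef M \<longleftrightarrow> symmetric_matrix M \<and> (\<forall>v. v \<bullet> (M *v v) \<ge> 0)"

definition covariance_matrix :: "'w measure \<Rightarrow> ('w \<Rightarrow> real^'d) \<Rightarrow> real^'d^'d" where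
  "covariance_matrix P X =
     (let \<mu> = integral\<^sup>L P X in integral\<^sup>L P (\<lambda>\<omega>. outer (X \<omega> - \<mu>) (X \<omega> - \<mu>)))"


section \<open>The finite-sum quadratic problem\<close>

text \<open>The objective is the average of the functions
  \<open>f i x = (x \<bullet> (A i *v x)) / 2 + b i \<bullet> x\<close> for \<open>i \<in> {1..n}\<close>.\<close>

definition mean :: "nat \<Rightarrow> (nat \<Rightarrow> 'v::real_vector) \<Rightarrow> 'v" where
  "mean n c = (1 / real n) *\<^sub>R (\<Sum>i=1..n. c i)"

definition minimizer :: "nat \<Rightarrow> (nat \<Rightarrow> real^'d^'d) \<Rightarrow> (nat \<Rightarrow> real^'d) \<Rightarrow> real^'d" where
  "minimizer n A b = - (matrix_inv (mean n A) *v mean n b)"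

definition noise :: "nat \<Rightarrow> (nat \<Rightarrow> real^'d^'d) \<Rightarrow> (nat \<Rightarrow> real^'d) \<Rightarrow> nat \<Rightarrow> real^'d" where
  "noise n A b i = - (A i *v (matrix_inv (mean n A) *v mean n b)) + b i"

definition noise_cov :: "nat \<Rightarrow> (nat \<Rightarrow> real^'d^'d) \<Rightarrow> (nat \<Rightarrow> real^'d) \<Rightarrow> real^'d^'d" where
  "noise_cov n A b = mean n (\<lambda>i. outer (noise n A b i) (noise n A b i))"

definition zeroth_order_gradient ::
    "nat \<Rightarrow> (nat \<Rightarrow> real^'d^'d) \<Rightarrow> (nat \<Rightarrow> real^'d) \<Rightarrow> nat \<Rightarrow> real^'d \<Rightarrow> real^'d" where
  "zeroth_order_gradient n A b i x = mean n A *v x + noise n A b i + mean n b"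


section \<open>SGD with momentum\<close>

definition sgdm_recursion ::
    "nat \<Rightarrow> (nat \<Rightarrow> real^'d^'d) \<Rightarrow> (nat \<Rightarrow> real^'d) \<Rightarrow> real \<Rightarrow> real
      \<Rightarrow> (int \<Rightarrow> nat) \<Rightarrow> (int \<Rightarrow> real^'d) \<Rightarrow> bool" where
  "sgdm_recursion n A b \<gamma> \<alpha> idx x \<longleftrightarrow>
     (\<forall>k. x (k + 1) =
        x k + \<alpha> *\<^sub>R (x k - x (k - 1)) - \<gamma> *\<^sub>R zeroth_order_gradient n A b (idx k) (x k))"

text \<open>A scalar multiple \<open>c M\<close> of a complex matrix is written \<open>mat c ** M\<close>.\<close>

definition transfer_matrix :: "real^'d^'d \<Rightarrow> real \<Rightarrow> real \<Rightarrow> complex \<Rightarrow> complex^'d^'d" where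
  "transfer_matrix M \<gamma> \<alpha> z =
     mat (- of_real \<gamma> * z) **
       matrix_inv (mat (z\<^sup>2)
         - mat z ** map_matrix of_real ((1 + \<alpha>) *\<^sub>R mat 1 - \<gamma> *\<^sub>R M)
         + mat (of_real \<alpha>))"

text \<open>The matrices \<open>H k\<close> are the Laurent coefficients of the transfer matrix on the unit circle;
  they are real because the transfer matrix commutes with complex conjugation.\<close>

definition impulse_response ::
    "real^'d^'d \<Rightarrow> real \<Rightarrow> real \<Rightarrow> (int \<Rightarrow> real^'d^'d) \<Rightarrow> bool" where
  "impulse_response M \<gamma> \<alpha> H \<longleftrightarrow>
     (\<forall>z. norm z = 1 \<longrightarrow>
        ((\<lambda>k. mat (z powi (- k)) ** map_matrix of_real (H k)) has_sum transfer_matrix M \<gamma> \<alpha> z) UNIV)"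

text \<open>Besides the convolution formula we also record the SGDM recursion. The latter follows from
  the former whenever \<open>H\<close> is the impulse response and the transfer matrix has no pole on the
  unit circle.\<close>

definition stationary_iterates ::
    "nat \<Rightarrow> (nat \<Rightarrow> real^'d^'d) \<Rightarrow> (nat \<Rightarrow> real^'d) \<Rightarrow> real \<Rightarrow> real
      \<Rightarrow> (int \<Rightarrow> real^'d^'d) \<Rightarrow> (int \<Rightarrow> nat) \<Rightarrow> (int \<Rightarrow> real^'d) \<Rightarrow> bool" where
  "stationary_iterates n A b \<gamma> \<alpha> H idx x \<longleftrightarrow>
     sgdm_recursion n A b \<gamma> \<alpha> idx x \<and>
     (\<forall>k. x k - minimizer n A b = (\<Sum>\<^sub>\<infinity>j. H (k - j) *v noise n A b (idx j)))"


section \<open>Shuffle-once sampling\<close>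

text \<open>The permutation \<open>(i\<^sub>0, \<dots>, i\<^bsub>n-1\<^esub>)\<close> of \<open>{1..n}\<close> is a list, extended \<open>n\<close>-periodically to \<open>\<int>\<close>.\<close>

definition so_index :: "nat \<Rightarrow> nat list \<Rightarrow> int \<Rightarrow> nat" where
  "so_index n p k = p ! nat (k mod int n)"

definition shuffle_once :: "nat \<Rightarrow> nat list pmf" where
  "shuffle_once n = pmf_of_set (permutations_of_set {1..n})"

end

theory Submission
  imports Defs
begin

text \<open>The convolution formula makes the iterates \<open>n\<close>-periodic in time and equivariant under cyclic
  rotation of the permutation, so the variance at a fixed time equals its average over one period.
  In the eigenbasis of the mean matrix the recursion decouples into scalar linear recursions, which
  the discrete Fourier transform diagonalises; Parseval's identity then reduces the claim to the
  mean square of the Fourier coefficients of a randomly permuted sequence with sum zero.\<close>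

section \<open>Discrete Fourier transform\<close>

text \<open>Integer exponents let inverses and conjugates be written as negated exponents.\<close>

definition root_of_unity :: "nat \<Rightarrow> int \<Rightarrow> complex" where
  "root_of_unity n k = cis (2 * pi * of_int k / of_nat n)"

text \<open>The signal lives on the integers, like the iterates; only the window from 0 to
  \<open>n - 1\<close> is sampled. Without normalisation, Parseval's identity carries a factor
  \<open>n\<close>.\<close>

definition dft :: "nat \<Rightarrow> (int \<Rightarrow> real) \<Rightarrow> nat \<Rightarrow> complex" where
  "dft n f m = (\<Sum>k<n. of_real (f (int k)) * root_of_unity n (- (int m * int k)))"

lemma root_of_unity_0 [simp]: "root_of_unity n 0 = 1"
  by (simp add: root_of_unity_def)

lemma root_of_unity_add: "root_of_unity n (j + k) = root_of_unity n j * root_of_unity n k"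
  by (simp add: root_of_unity_def cis_mult add_divide_distrib distrib_left)

lemma cnj_root_of_unity: "cnj (root_of_unity n k) = root_of_unity n (- k)"
  by (simp add: root_of_unity_def cis_cnj)

lemma norm_root_of_unity [simp]: "cmod (root_of_unity n k) = 1"
  by (simp add: root_of_unity_def)

lemma root_of_unity_mult_nat: "root_of_unity n (k * int m) = root_of_unity n k ^ m"
  by (simp add: root_of_unity_def Complex.DeMoivre mult_ac)

lemma root_of_unity_eq_1_iff:
  assumes "n > 0"
  shows "root_of_unity n k = 1 \<longleftrightarrow> int n dvd k"
proof -
  have "root_of_unity n k = 1 \<longleftrightarrow> (\<exists>j::int. 2 * pi * of_int k / of_nat n = of_int (2 * j) * pi)"
    unfolding root_of_unity_def cis_conv_exp by (simp add: exp_eq_1)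
  also have "\<dots> \<longleftrightarrow> (\<exists>j::int. real_of_int k = of_int (int n * j))"
    using assms by (intro ex_cong1) (simp add: field_simps)
  also have "\<dots> \<longleftrightarrow> int n dvd k"
    unfolding of_int_eq_iff by (simp add: dvd_def)
  finally show ?thesis .
qed

text \<open>Orthogonality of characters: a geometric sum whose ratio is an \<open>n\<close>-th root
  of unity is degenerate if the ratio is 1 and vanishes otherwise.\<close>

lemma sum_root_of_unity:
  assumes "n > 0"
  shows "(\<Sum>m<n. root_of_unity n (k * int m)) = (if int n dvd k then of_nat n else 0)"
proof (cases "int n dvd k")
  case True
  then have "root_of_unity n k = 1"
    using assms by (simp add: root_of_unity_eq_1_iff)
  then show ?thesis
    using True by (simp add: root_of_unity_mult_nat)
next
  case False
  then have ne: "root_of_unity n k \<noteq> 1"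
    using assms by (simp add: root_of_unity_eq_1_iff)
  have "root_of_unity n k ^ n = 1"
    using assms by (simp flip: root_of_unity_mult_nat add: root_of_unity_eq_1_iff)
  then show ?thesis
    using False geometric_sum[OF ne, of n] by (simp add: root_of_unity_mult_nat)
qed

text \<open>The expansion into pairs serves twice: summing over \<open>m\<close> gives Parseval's
  identity, and averaging over permutations leaves only pair correlations of the signal.\<close>

lemma norm_square_dft:
  "of_real ((cmod (dft n f m))\<^sup>2) =
     (\<Sum>j<n. \<Sum>l<n. of_real (f (int j) * f (int l)) * root_of_unity n ((int l - int j) * int m))"
proof -
  have "of_real ((cmod (dft n f m))\<^sup>2) = dft n f m * cnj (dft n f m)"
    by (rule complex_norm_square)
  also have "\<dots> = (\<Sum>j<n. \<Sum>l<n. of_real (f (int j) * f (int l)) * 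
      (root_of_unity n (- (int m * int j)) * root_of_unity n (int m * int l)))"
    unfolding dft_def cnj_sum sum_product by (simp add: cnj_root_of_unity mult_ac)
  finally show ?thesis
    by (simp flip: root_of_unity_add add: algebra_simps)
qed

lemma int_dvd_diff_iff:
  assumes "j < n" "l < n"
  shows "int n dvd int l - int j \<longleftrightarrow> l = j"
  using assms by (metis mod_eq_dvd_iff mod_pos_pos_trivial of_nat_0_le_iff of_nat_eq_iff of_nat_less_iff)

text \<open>With the sum over \<open>m\<close> moved innermost, orthogonality of characters keeps
  only the diagonal pairs, each with weight \<open>n\<close>.\<close>

lemma parseval_dft:
  assumes "n > 0"
  shows "(\<Sum>m<n. (cmod (dft n f m))\<^sup>2) = real n * (\<Sum>k<n. (f (int k))\<^sup>2)"
proof -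
  have "complex_of_real (\<Sum>m<n. (cmod (dft n f m))\<^sup>2) =
     (\<Sum>m<n. \<Sum>j<n. \<Sum>l<n. of_real (f (int j) * f (int l)) * root_of_unity n ((int l - int j) * int m))"
    unfolding of_real_sum norm_square_dft ..
  also have "\<dots> = (\<Sum>j<n. \<Sum>m<n. \<Sum>l<n. of_real (f (int j) * f (int l)) * root_of_unity n ((int l - int j) * int m))"
    by (rule sum.swap)
  also have "\<dots> = (\<Sum>j<n. \<Sum>l<n. of_real (f (int j) * f (int l)) * 
      (\<Sum>m<n. root_of_unity n ((int l - int j) * int m)))"
    unfolding sum_distrib_left by (intro sum.cong refl sum.swap)
  also have "\<dots> = (\<Sum>j<n. \<Sum>l<n. if l = j then of_real (f (int j) * f (int l)) * of_nat n else 0)"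
    using assms by (intro sum.cong refl) (auto simp: sum_root_of_unity int_dvd_diff_iff)
  also have "\<dots> = of_real (real n * (\<Sum>k<n. (f (int k))\<^sup>2))"
    by (simp add: sum_distrib_left power2_eq_square mult_ac)
  finally show ?thesis
    unfolding of_real_eq_iff .
qed

section \<open>Periodic solutions of a second-order recursion\<close>

text \<open>The sum over \<open>n + 1\<close> consecutive terms is split once at its first and once
  at its last term; these agree by periodicity and cancel.\<close>

lemma sum_periodic_shift:
  fixes g :: "int \<Rightarrow> 'a::cancel_comm_monoid_add"
  assumes "\<And>k. g (k + int n) = g k"
  shows "(\<Sum>k<n. g (int k + 1)) = (\<Sum>k<n. g (int k))"
proof -
  have "g 0 + (\<Sum>k<n. g (int k + 1)) = (\<Sum>k<Suc n. g (int k))"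
    by (simp only: sum.lessThan_Suc_shift) (simp add: add.commute)
  also have "\<dots> = g 0 + (\<Sum>k<n. g (int k))"
    using assms[of 0] by (simp add: add.commute)
  finally show ?thesis by simp
qed

lemma sum_periodic_shift_back:
  fixes g :: "int \<Rightarrow> 'a::cancel_comm_monoid_add"
  assumes "\<And>k. g (k + int n) = g k"
  shows "(\<Sum>k<n. g (int k - 1)) = (\<Sum>k<n. g (int k))"
proof -
  have "g (k + int n - 1) = g (k - 1)" for k
    using assms[of "k - 1"] by (simp add: algebra_simps)
  from sum_periodic_shift[of "\<lambda>k. g (k - 1)" n, OF this] show ?thesis
    by simp
qed

lemma root_of_unity_periodic:
  "root_of_unity n (- (int m * (k + int n))) = root_of_unity n (- (int m * k))"
proof (cases "n = 0")
  case False
  then have "root_of_unity n (- (int m * int n)) = 1"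
    by (simp add: root_of_unity_eq_1_iff)
  moreover have "- (int m * (k + int n)) = - (int m * k) + - (int m * int n)"
    by (simp add: algebra_simps)
  ultimately show ?thesis
    by (simp only: root_of_unity_add mult_1_right)
qed (simp add: root_of_unity_def)

text \<open>The characteristic polynomial \<open>z^2 - c z + \<alpha>\<close> of the scalar
  recursion, divided by \<open>z\<close>, at \<open>z = root_of_unity n m\<close>.\<close>

definition char_factor :: "nat \<Rightarrow> real \<Rightarrow> real \<Rightarrow> nat \<Rightarrow> complex" where
  "char_factor n c \<alpha> m =
     root_of_unity n (int m) - of_real c + of_real \<alpha> * root_of_unity n (- int m)"

text \<open>A time shift by one multiplies a Fourier coefficient by a root of unity. Periodicity of
  \<open>s\<close> allows the shifted summation windows to be replaced by the original one.\<close>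

lemma dft_recursion:
  assumes per: "\<And>k. s (k + int n) = s k"
    and rec: "\<And>k. s (k + 1) = c * s k - \<alpha> * s (k - 1) - \<gamma> * w k"
  shows "dft n s m * char_factor n c \<alpha> m = - of_real \<gamma> * dft n w m"
proof -
  define e where "e k = root_of_unity n (- (int m * k))" for k
  define g where "g k = of_real (s k) * e k" for k
  have gper: "g (k + int n) = g k" for k
    unfolding g_def e_def root_of_unity_periodic per ..
  \<comment> \<open>The character is moved to the time of the sample it multiplies, so that only
    values of \<open>g\<close> remain.\<close>
  have e1: "e k = root_of_unity n (int m) * e (k + 1)" for k
    unfolding e_def root_of_unity_add[symmetric] by (simp add: algebra_simps)
  have e2: "e k = root_of_unity n (- int m) * e (k - 1)" for k
    unfolding e_def root_of_unity_add[symmetric] by (simp add: algebra_simps)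
  have "of_real \<gamma> * (of_real (w k) * e k) =
      of_real c * g k - of_real \<alpha> * root_of_unity n (- int m) * g (k - 1)
      - root_of_unity n (int m) * g (k + 1)" for k
  proof -
    have "of_real \<gamma> * (of_real (w k) * e k) = of_real (c * s k - \<alpha> * s (k - 1) - s (k + 1)) * e k"
      using rec[of k] by simp
    also have "\<dots> = of_real c * (of_real (s k) * e k) - of_real \<alpha> * (of_real (s (k - 1)) * e k)
        - of_real (s (k + 1)) * e k"
      by (simp add: algebra_simps)
    also have "of_real (s (k - 1)) * e k = root_of_unity n (- int m) * g (k - 1)"
      unfolding g_def by (subst e2) simp
    also have "of_real (s (k + 1)) * e k = root_of_unity n (int m) * g (k + 1)"
      unfolding g_def by (subst e1) simp
    finally show ?thesis by (simp add: g_def[of k] mult_ac)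
  qed
  then have "of_real \<gamma> * (\<Sum>k<n. of_real (w (int k)) * e (int k)) =
      of_real c * (\<Sum>k<n. g (int k)) - of_real \<alpha> * root_of_unity n (- int m) * (\<Sum>k<n. g (int k - 1))
      - root_of_unity n (int m) * (\<Sum>k<n. g (int k + 1))"
    by (simp add: sum_distrib_left sum_subtractf)
  then have "of_real \<gamma> * dft n w m = (\<Sum>k<n. g (int k)) *
      (of_real c - of_real \<alpha> * root_of_unity n (- int m) - root_of_unity n (int m))"
    unfolding sum_periodic_shift[of g, OF gper] sum_periodic_shift_back[of g, OF gper]
    by (simp add: dft_def e_def algebra_simps)
  also have "(\<Sum>k<n. g (int k)) = dft n s m"
    by (simp add: dft_def g_def e_def)
  finally show ?thesis
    by (simp add: char_factor_def algebra_simps)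
qed

text \<open>At angle \<open>t\<close> the factor has real part
  \<open>(1 + \<alpha>) cos t - c\<close> and imaginary part \<open>(1 - \<alpha>) sin t\<close>. If
  both vanish, then \<open>cos t\<close> is 1 or -1, so \<open>c\<close> is
  \<open>1 + \<alpha>\<close> or \<open>-(1 + \<alpha>)\<close>, which the bounds on
  \<open>c\<close> exclude.\<close>

lemma char_factor_nonzero:
  assumes "0 \<le> c" "c < 1 + \<alpha>" "0 \<le> \<alpha>" "\<alpha> < 1"
  shows "char_factor n c \<alpha> m \<noteq> 0"
proof
  assume 0: "char_factor n c \<alpha> m = 0"
  define t where "t = 2 * pi * real m / real n"
  have "Im (char_factor n c \<alpha> m) = (1 - \<alpha>) * sin t" "Re (char_factor n c \<alpha> m) = (1 + \<alpha>) * cos t - c"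
    by (simp_all add: char_factor_def root_of_unity_def t_def algebra_simps)
  with 0 assms have *: "sin t = 0" "(1 + \<alpha>) * cos t = c" by auto
  then have "(cos t)\<^sup>2 = 1"
    using sin_cos_squared_add[of t] by simp
  then have "cos t = 1 \<or> cos t = -1"
    by (simp add: power2_eq_1_iff)
  with * assms show False by auto
qed

text \<open>With \<open>e\<close> the root of unity of exponent \<open>-m\<close>, the quadratic
  \<open>e^2 - c e + \<alpha>\<close> is \<open>e\<close> times the conjugate of the factor, and
  neither \<open>e\<close> nor conjugation changes the modulus.\<close>

lemma norm_char_factor:
  "cmod (char_factor n c \<alpha> m) = 
     cmod (exp (- (4 * of_real pi * \<i> * of_nat m / of_nat n))
                - exp (- (2 * of_real pi * \<i> * of_nat m / of_nat n)) * of_real c + of_real \<alpha>)"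
proof -
  let ?e = "root_of_unity n (- int m)"
  have e1: "exp (- (2 * of_real pi * \<i> * of_nat m / of_nat n)) = ?e"
    by (simp add: root_of_unity_def cis_conv_exp mult_ac)
  have e2: "exp (- (4 * of_real pi * \<i> * of_nat m / of_nat n)) = ?e * ?e"
    unfolding e1[symmetric] by (simp add: mult_ac flip: exp_add)
  have "?e * root_of_unity n (int m) = 1"
    by (simp flip: root_of_unity_add)
  then have "?e * ?e - ?e * of_real c + of_real \<alpha> = ?e * cnj (char_factor n c \<alpha> m)"
    by (simp add: char_factor_def cnj_root_of_unity algebra_simps)
  then show ?thesis
    unfolding e1 e2 by (simp add: norm_mult)
qed

text \<open>At each frequency the recursion is solved by dividing by the nonzero characteristic
  factor; Parseval's identity returns to the time domain.\<close>

lemma sum_squares_periodic_solution: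
  assumes "n > 0"
    and "\<And>k. s (k + int n) = s k"
    and "\<And>k. s (k + 1) = c * s k - \<alpha> * s (k - 1) - \<gamma> * w k"
    and "0 \<le> c" "c < 1 + \<alpha>" "0 \<le> \<alpha>" "\<alpha> < 1"
  shows "(\<Sum>k<n. (s (int k))\<^sup>2) =
     \<gamma>\<^sup>2 / real n * (\<Sum>m<n. (cmod (dft n w m))\<^sup>2 / (cmod (char_factor n c \<alpha> m))\<^sup>2)"
proof -
  have "(cmod (dft n s m))\<^sup>2 = \<gamma>\<^sup>2 * ((cmod (dft n w m))\<^sup>2 / (cmod (char_factor n c \<alpha> m))\<^sup>2)" for m
  proof -
    have "(cmod (dft n s m * char_factor n c \<alpha> m))\<^sup>2 = (cmod (of_real \<gamma> * dft n w m))\<^sup>2"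
      using dft_recursion[of s n c \<alpha> \<gamma> w m] assms by simp
    then have "(cmod (dft n s m))\<^sup>2 * (cmod (char_factor n c \<alpha> m))\<^sup>2 = \<gamma>\<^sup>2 * (cmod (dft n w m))\<^sup>2"
      by (simp add: norm_mult power_mult_distrib)
    moreover have "cmod (char_factor n c \<alpha> m) \<noteq> 0"
      using char_factor_nonzero assms by simp
    ultimately show ?thesis
      by (simp add: field_simps)
  qed
  then have "real n * (\<Sum>k<n. (s (int k))\<^sup>2) =
      \<gamma>\<^sup>2 * (\<Sum>m<n. (cmod (dft n w m))\<^sup>2 / (cmod (char_factor n c \<alpha> m))\<^sup>2)"
    using parseval_dft[OF assms(1), of s] by (simp add: sum_distrib_left)
  then show ?thesis
    using assms(1) by (simp add: field_simps)
qed

text \<open>Summed over one period, the recursion reads \<open>(1 + \<alpha> - c) S = 0\<close> for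
  the period sum \<open>S\<close>.\<close>

lemma sum_periodic_solution_eq_0:
  fixes s w :: "int \<Rightarrow> real"
  assumes "\<And>k. s (k + int n) = s k"
    and "\<And>k. s (k + 1) = c * s k - \<alpha> * s (k - 1) - \<gamma> * w k"
    and "c \<noteq> 1 + \<alpha>" and "(\<Sum>k<n. w (int k)) = 0"
  shows "(\<Sum>k<n. s (int k)) = 0"
proof -
  have "(\<Sum>k<n. s (int k)) = c * (\<Sum>k<n. s (int k)) - \<alpha> * (\<Sum>k<n. s (int k)) - \<gamma> * (\<Sum>k<n. w (int k))"
    using sum_periodic_shift[of s, OF assms(1)] sum_periodic_shift_back[of s, OF assms(1)]
    by (simp add: assms(2) sum_subtractf flip: sum_distrib_left)
  then have "(1 + \<alpha> - c) * (\<Sum>k<n. s (int k)) = 0"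
    using assms(4) by (simp add: algebra_simps)
  then show ?thesis
    using assms(3) by simp
qed

section \<open>Random permutations\<close>

lemma length_permutation: "p \<in> permutations_of_set {1..n} \<Longrightarrow> length p = n"
  using length_finite_permutations_of_set by fastforce

lemma sum_nth_permutation:
  assumes "p \<in> permutations_of_set {1..n}"
  shows "(\<Sum>j<n. f (p ! j)) = (\<Sum>i=1..n. f i)"
proof -
  have "bij_betw ((!) p) {..<n} {1..n}"
    using assms bij_betw_nth[of p "{..<n}" "{1..n}"] length_permutation[OF assms]
    by (auto simp: permutations_of_set_def)
  then show ?thesis
    by (rule sum.reindex_bij_betw)
qed

text \<open>Exchangeability of positions: transposing two entries is an involution on the
  permutations. Moments therefore do not depend on which positions are taken.\<close>

lemma sum_permutations_swap:
  assumes "j < n" "l < n"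
  shows "(\<Sum>p\<in>permutations_of_set {1..n}. g (p[j := p ! l, l := p ! j])) =
         (\<Sum>p\<in>permutations_of_set {1..n}. g p)"
proof -
  let ?f = "\<lambda>p. p[j := p ! l, l := p ! j]"
  have mem: "?f p \<in> permutations_of_set {1..n}" if "p \<in> permutations_of_set {1..n}" for p :: "nat list"
    using that length_permutation[OF that] assms
    by (simp add: permutations_of_set_def)
  have inv: "?f (?f p) = p" if "p \<in> permutations_of_set {1..n}" for p :: "nat list"
    using length_permutation[OF that] assms
    by (intro nth_equalityI) (auto simp: nth_list_update)
  show ?thesis
    by (rule sum.reindex_bij_witness[of _ ?f ?f]) (use mem inv in auto)
qed

text \<open>Invariance of the uniform distribution under rotation, later used to trade a time step
  for a change of permutation.\<close>

lemma sum_permutations_rotate1: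
  "(\<Sum>p\<in>permutations_of_set A. g (rotate1 p)) = (\<Sum>p\<in>permutations_of_set A. g p)"
proof (rule sum.reindex_bij_betw)
  show "bij_betw rotate1 (permutations_of_set A) (permutations_of_set A)"
  proof (rule bij_betwI')
    fix p assume p: "p \<in> permutations_of_set A"
    \<comment> \<open>The preimage under one rotation is the rotation by one less than the full
      length; the empty list is fixed.\<close>
    have "p = rotate1 (rotate (length p - 1) p)"
    proof (cases p)
      case (Cons a q)
      then show ?thesis
        by (metis One_nat_def Suc_pred length_greater_0_conv list.distinct(1) rotate_Suc
            rotate_id mod_self)
    qed simp
    moreover have "rotate (length p - 1) p \<in> permutations_of_set A"
      using p by (simp add: permutations_of_set_def)
    ultimately show "\<exists>q\<in>permutations_of_set A. p = rotate1 q" by blast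
  qed (auto simp: permutations_of_set_def inj_eq[OF inj_rotate1])
qed

text \<open>By exchangeability every position contributes equally, and all positions together give
  the full sum of squares for each of the \<open>fact n\<close> permutations.\<close>

lemma sum_permutations_square:
  fixes w :: "nat \<Rightarrow> real"
  assumes "j < n"
  shows "(\<Sum>p\<in>permutations_of_set {1..n}. (w (p ! j))\<^sup>2) = fact n * mean n (\<lambda>i. (w i)\<^sup>2)"
proof -
  let ?F = "\<lambda>j. \<Sum>p\<in>permutations_of_set {1..n}. (w (p ! j))\<^sup>2"
  have eq: "?F l = ?F j" if "l < n" for l
    using sum_permutations_swap[OF that assms, of "\<lambda>p. (w (p ! j))\<^sup>2"] that assms
    by (simp add: length_permutation nth_list_update cong: sum.cong)
  have "real n * ?F j = (\<Sum>l<n. ?F j)"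
    by simp
  also have "\<dots> = (\<Sum>l<n. ?F l)"
    by (intro sum.cong refl eq[symmetric]) simp
  also have "\<dots> = (\<Sum>p\<in>permutations_of_set {1..n}. \<Sum>l<n. (w (p ! l))\<^sup>2)"
    by (rule sum.swap)
  also have "\<dots> = fact n * (\<Sum>i=1..n. (w i)\<^sup>2)"
    by (simp add: sum_nth_permutation[where f = "\<lambda>i. (w i)\<^sup>2"])
  finally show ?thesis
    using assms by (simp add: mean_def field_simps)
qed

text \<open>The negative correlation of sampling without replacement: as \<open>w\<close> sums to
  zero, the products with all positions cancel, so the \<open>n - 1\<close> equal off-diagonal terms
  balance the diagonal one.\<close>

lemma sum_permutations_product:
  fixes w :: "nat \<Rightarrow> real"
  assumes "j < n" "l < n" "j \<noteq> l" and sum0: "(\<Sum>i=1..n. w i) = 0"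
  shows "(\<Sum>p\<in>permutations_of_set {1..n}. w (p ! j) * w (p ! l)) =
           - (fact n * mean n (\<lambda>i. (w i)\<^sup>2)) / (real n - 1)"
proof -
  let ?F = "\<lambda>l. \<Sum>p\<in>permutations_of_set {1..n}. w (p ! j) * w (p ! l)"
  \<comment> \<open>Transposing \<open>l\<close> and \<open>l'\<close> leaves position
    \<open>j\<close> untouched, since both differ from \<open>j\<close>.\<close>
  have eq: "?F l' = ?F l" if "l' \<in> {..<n} - {j}" for l'
    using sum_permutations_swap[of l n l' "\<lambda>p. w (p ! j) * w (p ! l')"] that assms
    by (simp add: length_permutation nth_list_update cong: sum.cong)
  have "(real n - 1) * ?F l = (\<Sum>l'\<in>{..<n} - {j}. ?F l)"
    using assms by simp
  also have "\<dots> = (\<Sum>l'\<in>{..<n} - {j}. ?F l')"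
    by (intro sum.cong refl eq[symmetric])
  also have "\<dots> = (\<Sum>l'<n. ?F l') - ?F j"
    using assms by (simp add: sum_diff1)
  also have "(\<Sum>l'<n. ?F l') = (\<Sum>p\<in>permutations_of_set {1..n}. w (p ! j) * (\<Sum>l'<n. w (p ! l')))"
    unfolding sum_distrib_left by (rule sum.swap)
  also have "\<dots> = 0"
    using sum0 by (simp add: sum_nth_permutation)
  also have "?F j = fact n * mean n (\<lambda>i. (w i)\<^sup>2)"
    using sum_permutations_square[OF assms(1), of w] by (simp add: power2_eq_square)
  finally show ?thesis
    using assms by (simp add: field_simps)
qed

section \<open>Periodic index sequences and the mean power spectrum of a permuted sequence\<close>

lemma so_index_nth: "k < n \<Longrightarrow> so_index n p (int k) = p ! k"
  by (simp add: so_index_def flip: of_nat_mod)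

lemma so_index_periodic: "so_index n p (k + int n) = so_index n p k"
  by (simp add: so_index_def)

text \<open>Rotating the list amounts to advancing time by one, also across the end of a
  period.\<close>

lemma so_index_rotate1:
  assumes "length p = n" "n > 0"
  shows "so_index n (rotate1 p) k = so_index n p (k + 1)"
proof -
  have "int (Suc (nat (k mod int n)) mod n) = (k + 1) mod int n"
    using assms by (simp add: of_nat_mod mod_simps add.commute)
  then have "nat ((k + 1) mod int n) = Suc (nat (k mod int n)) mod n"
    by linarith
  moreover have "nat (k mod int n) < n"
    using assms by (simp add: nat_less_iff)
  ultimately show ?thesis
    using assms by (simp add: so_index_def nth_rotate1)
qed

text \<open>The pair correlations are a multiple of the identity minus a constant. The constant part
  is invisible at a nonzero frequency, so the spectrum is flat: the value is the same for all
  \<open>m\<close>.\<close>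

lemma sum_permutations_dft:
  fixes w :: "nat \<Rightarrow> real"
  assumes m: "0 < m" "m < n" and sum0: "(\<Sum>i=1..n. w i) = 0"
  shows "(\<Sum>p\<in>permutations_of_set {1..n}. (cmod (dft n (\<lambda>k. w (so_index n p k)) m))\<^sup>2) =
           (real n)\<^sup>2 / (real n - 1) * (fact n * mean n (\<lambda>i. (w i)\<^sup>2))"
proof -
  let ?P = "permutations_of_set {1..n}"
  define V where "V = fact n * mean n (\<lambda>i. (w i)\<^sup>2)"
  define R where "R j l = root_of_unity n ((int l - int j) * int m)" for j l
  \<comment> \<open>One formula for both cases: on the diagonal,
    \<open>V n / (n - 1) - V / (n - 1) = V\<close>.\<close>
  have corr: "(\<Sum>p\<in>?P. w (p ! j) * w (p ! l)) =
      (if j = l then V * real n / (real n - 1) else 0) - V / (real n - 1)"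
    if "j < n" "l < n" for j l
  proof (cases "j = l")
    case True
    have "V = (V * real n - V) / (real n - 1)"
      using m by (simp add: field_simps)
    with True show ?thesis
      using sum_permutations_square[OF that(1), of w]
      by (simp add: V_def power2_eq_square diff_divide_distrib)
  next
    case False
    then show ?thesis
      using sum_permutations_product[OF that False sum0] by (simp add: V_def)
  qed
  \<comment> \<open>A nontrivial character sums to zero over a period; this removes the constant
    part of \<open>corr\<close>.\<close>
  have R0: "(\<Sum>l<n. R j l) = 0" for j
  proof -
    have "(\<Sum>l<n. R j l) = root_of_unity n (- (int j * int m)) * (\<Sum>l<n. root_of_unity n (int m * int l))"
      unfolding R_def sum_distrib_left root_of_unity_add[symmetric] by (simp add: algebra_simps)
    also have "\<not> int n dvd int m"
      using m by (auto dest: dvd_imp_le)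
    then have "(\<Sum>l<n. root_of_unity n (int m * int l)) = 0"
      using m by (simp add: sum_root_of_unity)
    finally show ?thesis by simp
  qed
  have "complex_of_real (\<Sum>p\<in>?P. (cmod (dft n (\<lambda>k. w (so_index n p k)) m))\<^sup>2) =
     (\<Sum>p\<in>?P. \<Sum>j<n. \<Sum>l<n. of_real (w (p ! j) * w (p ! l)) * R j l)"
    unfolding of_real_sum norm_square_dft R_def by (simp add: so_index_nth)
  also have "\<dots> = (\<Sum>j<n. \<Sum>p\<in>?P. \<Sum>l<n. of_real (w (p ! j) * w (p ! l)) * R j l)"
    by (rule sum.swap)
  also have "\<dots> = (\<Sum>j<n. \<Sum>l<n. of_real (\<Sum>p\<in>?P. w (p ! j) * w (p ! l)) * R j l)"
    unfolding of_real_sum sum_distrib_right by (intro sum.cong refl sum.swap)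
  also have "\<dots> = (\<Sum>j<n. \<Sum>l<n. (if j = l then of_real (V * real n / (real n - 1)) else 0)
      - of_real (V / (real n - 1)) * R j l)"
  proof (intro sum.cong refl)
    fix j l assume "j \<in> {..<n}" "l \<in> {..<n}"
    then have "j < n" "l < n" by auto
    from corr[OF this]
    show "of_real (\<Sum>p\<in>?P. w (p ! j) * w (p ! l)) * R j l =
        (if j = l then of_real (V * real n / (real n - 1)) else 0) - of_real (V / (real n - 1)) * R j l"
      by (simp only: of_real_diff left_diff_distrib) (simp add: R_def)
  qed
  also have "\<dots> = (\<Sum>j<n. (\<Sum>l<n. if j = l then of_real (V * real n / (real n - 1)) else 0)
      - of_real (V / (real n - 1)) * (\<Sum>l<n. R j l))"
    by (simp only: sum_subtractf sum_distrib_left)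
  also have "\<dots> = of_real ((real n)\<^sup>2 / (real n - 1) * V)"
    by (simp add: R0 power2_eq_square mult_ac)
  finally show ?thesis
    unfolding of_real_eq_iff V_def .
qed

section \<open>Linear algebra\<close>

text \<open>The basis is indexed by the dimension type itself, so the matrix \<open>Q\<close> with
  rows \<open>u i\<close> is square and its right inverse \<open>transpose Q\<close> is also a left
  inverse.\<close>

lemma norm_square_orthonormal_basis:
  fixes u :: "'d::finite \<Rightarrow> real^'d" and v :: "real^'d"
  assumes "\<And>i j. u i \<bullet> u j = (if i = j then 1 else 0)"
  shows "v \<bullet> v = (\<Sum>i\<in>UNIV. (u i \<bullet> v)\<^sup>2)"
proof -
  define Q :: "real^'d^'d" where "Q = (\<chi> i. u i)"
  have "Q ** transpose Q = mat 1"
    by (simp add: Q_def matrix_matrix_mult_def transpose_def mat_def vec_eq_iff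
        flip: inner_vec_def[where ?'a = real, unfolded inner_real_def] assms)
  then have Q: "transpose Q ** Q = mat 1"
    by (simp add: matrix_left_right_inverse)
  have comp: "(Q *v v) $ i = u i \<bullet> v" for i
    by (simp add: Q_def matrix_vector_mult_def inner_vec_def)
  have "v \<bullet> v = v \<bullet> ((transpose Q ** Q) *v v)"
    by (simp add: Q)
  also have "\<dots> = (Q *v v) \<bullet> (Q *v v)"
    by (metis dot_lmul_matrix matrix_vector_mul_assoc transpose_matrix_vector inner_commute)
  also have "\<dots> = (\<Sum>i\<in>UNIV. (u i \<bullet> v)\<^sup>2)"
    by (subst inner_vec_def) (simp add: comp power2_eq_square)
  finally show ?thesis .
qed

lemma inner_symmetric_matrix:
  assumes "symmetric_matrix M"
  shows "v \<bullet> (M *v w) = (M *v v) \<bullet> w"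
  using assms by (metis dot_lmul_matrix symmetric_matrix_def transpose_matrix_vector)

text \<open>Positive definiteness makes the kernel trivial, so the matrix is invertible.\<close>

lemma pos_def_mult_inv:
  assumes "pos_def M"
  shows "M *v (matrix_inv M *v v) = v"
proof -
  have "\<forall>v. M *v v = 0 \<longrightarrow> v = 0"
    using assms by (metis inner_zero_right less_irrefl pos_def_def)
  then have "invertible M"
    by (simp add: invertible_left_inverse matrix_left_invertible_ker)
  then have "M ** matrix_inv M = mat 1"
    unfolding invertible_def matrix_inv_def by (rule someI2_ex) simp
  then show ?thesis
    by (simp add: matrix_vector_mul_assoc)
qed

lemma sum_matrix_vector_mult:
  fixes M :: "'i \<Rightarrow> real^'d^'e"
  shows "(\<Sum>i\<in>S. M i) *v v = (\<Sum>i\<in>S. M i *v v)"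
  by (induction S rule: infinite_finite_induct) (simp_all add: matrix_vector_mult_add_rdistrib)

section \<open>Means, outer products and the noise covariance\<close>

lemma mean_matrix_vector_mult:
  fixes M :: "nat \<Rightarrow> real^'d^'e"
  shows "mean n M *v v = mean n (\<lambda>i. M i *v v)"
  by (simp add: mean_def sum_matrix_vector_mult flip: scaleR_matrix_vector_assoc)

lemma inner_mean_right: "v \<bullet> mean n f = mean n (\<lambda>i. v \<bullet> f i)"
  by (simp add: mean_def inner_sum_right)

lemma outer_mult: "outer v w *v z = (w \<bullet> z) *\<^sub>R v"
  by (simp add: vec_eq_iff outer_def matrix_vector_mult_def inner_vec_def sum_distrib_left
      sum_distrib_right mult_ac)

lemma inner_noise_cov:
  "v \<bullet> (noise_cov n A b *v v) = mean n (\<lambda>i. (v \<bullet> noise n A b i)\<^sup>2)"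
  unfolding noise_cov_def mean_matrix_vector_mult inner_mean_right
  by (simp add: outer_mult inner_commute power2_eq_square)

text \<open>The noise averages to \<open>- M (M^-1 v) + v\<close>, where \<open>M\<close> is the
  mean matrix and \<open>v\<close> the mean of \<open>b\<close>.\<close>

lemma sum_noise:
  assumes "n > 0" "pos_def (mean n A)"
  shows "(\<Sum>i=1..n. noise n A b i) = 0"
proof -
  have "mean n (noise n A b) = - (mean n A *v (matrix_inv (mean n A) *v mean n b)) + mean n b"
    unfolding mean_matrix_vector_mult
    by (simp add: mean_def noise_def sum.distrib sum_negf scaleR_add_right sum_subtractf
        scaleR_diff_right)
  also have "\<dots> = 0"
    by (simp add: pos_def_mult_inv[OF assms(2)])
  finally show ?thesis
    using assms(1) by (simp add: mean_def)
qed

lemma trace_outer: "trace (outer v v) = v \<bullet> v"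
  by (simp add: trace_def outer_def inner_vec_def)

lemma trace_scaleR: "trace (c *\<^sub>R M) = c * trace (M :: real^'d^'d)"
  by (simp add: trace_def sum_distrib_left)

lemma trace_sum: "trace (\<Sum>i\<in>S. M i) = (\<Sum>i\<in>S. trace (M i :: real^'d^'d))"
  unfolding trace_def sum_component by (rule sum.swap)

section \<open>Expectation and covariance under a uniform permutation\<close>

lemma integral_shuffle_once:
  fixes f :: "nat list \<Rightarrow> 'b::{banach, second_countable_topology}"
  shows "integral\<^sup>L (measure_pmf (shuffle_once n)) f =
     (1 / fact n) *\<^sub>R (\<Sum>p\<in>permutations_of_set {1..n}. f p)"
proof -
  have "integral\<^sup>L (measure_pmf (shuffle_once n)) f =
      (\<Sum>p\<in>permutations_of_set {1..n}. pmf (shuffle_once n) p *\<^sub>R f p)"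
    by (rule integral_measure_pmf) (auto simp: shuffle_once_def)
  then show ?thesis
    by (simp add: shuffle_once_def scaleR_sum_right)
qed

text \<open>The hypothesis says that \<open>c\<close> is the expectation of \<open>X\<close>; the
  trace of each outer product is a squared norm.\<close>

lemma trace_covariance_shuffle_once:
  fixes X :: "nat list \<Rightarrow> real^'d"
  assumes "(\<Sum>p\<in>permutations_of_set {1..n}. X p - c) = 0"
  shows "trace (covariance_matrix (measure_pmf (shuffle_once n)) X) =
     (\<Sum>p\<in>permutations_of_set {1..n}. (X p - c) \<bullet> (X p - c)) / fact n"
proof -
  have "integral\<^sup>L (measure_pmf (shuffle_once n)) X = c"
    using assms by (simp add: integral_shuffle_once sum_subtractf sum_constant_scaleR del: sum_constant)
  then show ?thesis
    by (simp add: covariance_matrix_def integral_shuffle_once trace_scaleR trace_sum trace_outer)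
qed

section \<open>Stationary iterates\<close>

text \<open>The convolution is time invariant, as the substitution of \<open>j + c\<close> for
  \<open>j\<close> shows. Equal index sequences with \<open>c = n\<close> give periodicity, and a
  rotated permutation with \<open>c = 1\<close> gives equivariance.\<close>

lemma stationary_iterates_shift:
  assumes "stationary_iterates n A b \<gamma> \<alpha> H idx x" "stationary_iterates n A b \<gamma> \<alpha> H idx' x'"
    and "\<And>j. idx' j = idx (j + c)"
  shows "x' k = x (k + c)"
proof -
  have "(\<Sum>\<^sub>\<infinity>j. H (k - j) *v noise n A b (idx' j)) = (\<Sum>\<^sub>\<infinity>j. H (k + c - j) *v noise n A b (idx j))"
    by (rule infsum_reindex_bij_witness[of _ "\<lambda>j. j - c" "\<lambda>j. j + c"]) (auto simp: assms(3))
  then have "x' k - minimizer n A b = x (k + c) - minimizer n A b"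
    using assms(1,2) unfolding stationary_iterates_def by simp
  then show ?thesis by simp
qed

text \<open>Symmetry moves the mean matrix from the iterate onto the eigenvector, so each
  eigencoordinate of the error follows its own scalar recursion.\<close>

lemma sgdm_recursion_eigenvector:
  assumes pd: "pos_def (mean n A)" and eig: "mean n A *v v = l *\<^sub>R v"
    and "sgdm_recursion n A b \<gamma> \<alpha> idx x"
  defines "s \<equiv> \<lambda>k. v \<bullet> (x k - minimizer n A b)"
  shows "s (k + 1) = (1 + \<alpha> - \<gamma> * l) * s k - \<alpha> * s (k - 1) - \<gamma> * (v \<bullet> noise n A b (idx k))"
proof -
  let ?M = "mean n A" and ?m = "minimizer n A b"
  have mm: "?M *v ?m = - mean n b"
    by (simp add: minimizer_def pos_def_mult_inv[OF pd] linear_neg[OF matrix_vector_mul_linear])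
  have "v \<bullet> (?M *v x k + mean n b) = v \<bullet> (?M *v (x k - ?m))"
    by (simp add: matrix_vector_mult_diff_distrib mm)
  also have "\<dots> = l * s k"
    using pd eig by (simp add: s_def inner_symmetric_matrix pos_def_def)
  finally have g: "v \<bullet> (?M *v x k + mean n b) = l * s k" .
  \<comment> \<open>The coefficients \<open>1 + \<alpha>\<close> and \<open>- \<alpha>\<close> add
    up to 1, so the minimizer can be subtracted from every iterate at once.\<close>
  have "x (k + 1) - ?m = (1 + \<alpha>) *\<^sub>R (x k - ?m) - \<alpha> *\<^sub>R (x (k - 1) - ?m)
      - \<gamma> *\<^sub>R ((?M *v x k + mean n b) + noise n A b (idx k))"
    using assms(3)[unfolded sgdm_recursion_def zeroth_order_gradient_def, rule_format, of k]
    by (simp add: algebra_simps)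
  then have "s (k + 1) = (1 + \<alpha>) * s k - \<alpha> * s (k - 1)
      - \<gamma> * (v \<bullet> (?M *v x k + mean n b) + v \<bullet> noise n A b (idx k))"
    unfolding s_def by (simp only: inner_diff_right inner_scaleR_right inner_add_right)
  then show ?thesis
    unfolding g by (simp add: algebra_simps)
qed

theorem mainTheorem6:
  fixes n :: nat
    and A :: "nat \<Rightarrow> real^'d^'d" and b :: "nat \<Rightarrow> real^'d"
    and u :: "'d \<Rightarrow> real^'d" and lam :: "'d \<Rightarrow> real"
    and \<gamma> \<alpha> :: real
    and H :: "int \<Rightarrow> real^'d^'d"
    and x :: "nat list \<Rightarrow> int \<Rightarrow> real^'d"
    and k :: int
  assumes "n \<ge> 2"
    and "\<And>i. i \<in> {1..n} \<Longrightarrow> symmetric_matrix (A i)"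
    and "pos_def (mean n A)"
    and "\<And>i j. u i \<bullet> u j = (if i = j then 1 else 0)"
    and "\<And>i. mean n A *v u i = lam i *\<^sub>R u i"
    and "\<And>i. lam i > 0"
    and "\<gamma> > 0" and "0 \<le> \<alpha>" and "\<alpha> < 1"
    and "pos_semidef ((1 + \<alpha>) *\<^sub>R mat 1 - \<gamma> *\<^sub>R mean n A)"
    and "impulse_response (mean n A) \<gamma> \<alpha> H"
    and "\<And>p. p \<in> permutations_of_set {1..n} \<Longrightarrow>
           stationary_iterates n A b \<gamma> \<alpha> H (so_index n p) (x p)"
  shows "trace (covariance_matrix (measure_pmf (shuffle_once n)) (\<lambda>p. x p k)) =
    \<gamma>\<^sup>2 / (real n - 1) *
      (\<Sum>i\<in>UNIV. (u i \<bullet> (noise_cov n A b *v u i)) *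
        (\<Sum>k'=1..n - 1.
          cmod (exp (- (4 * of_real pi * \<i> * of_nat k' / of_nat n))
                - exp (- (2 * of_real pi * \<i> * of_nat k' / of_nat n))
                    * of_real (1 + \<alpha> - \<gamma> * lam i)
                + of_real \<alpha>) powi (-2)))"
proof -
  let ?P = "permutations_of_set {1..n}" and ?m = "minimizer n A b" and ?y = "noise n A b"
  define c where "c i = 1 + \<alpha> - \<gamma> * lam i" for i
  define w where "w i j = u i \<bullet> ?y j" for i j
  define s where "s i p k = u i \<bullet> (x p k - ?m)" for i p k
  define G where "G i = (\<Sum>m=1..n - 1. inverse ((cmod (char_factor n (c i) \<alpha> m))\<^sup>2))" for i
  have n: "n > 0" using assms(1) by simp
  note stat = assms(12)
  have c_less: "c i < 1 + \<alpha>" for i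
    using assms(6)[of i] assms(7) by (simp add: c_def)
  have c_ge: "c i \<ge> 0" for i
  proof -
    \<comment> \<open>Semidefiniteness is tested on the unit eigenvector \<open>u i\<close>, where
      the quadratic form equals \<open>c i\<close>.\<close>
    have "0 \<le> u i \<bullet> (((1 + \<alpha>) *\<^sub>R mat 1 - \<gamma> *\<^sub>R mean n A) *v u i)"
      using assms(10) by (simp add: pos_semidef_def)
    also have "\<dots> = c i"
      by (simp add: c_def matrix_vector_mult_diff_rdistrib assms(4,5) inner_diff_right
          flip: scaleR_matrix_vector_assoc)
    finally show ?thesis .
  qed
  have rec: "s i p (k + 1) = c i * s i p k - \<alpha> * s i p (k - 1) - \<gamma> * w i (so_index n p k)"
    if "p \<in> ?P" for i p k
  proof -
    have "sgdm_recursion n A b \<gamma> \<alpha> (so_index n p) (x p)"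
      using stat[OF that] by (simp add: stationary_iterates_def)
    from sgdm_recursion_eigenvector[OF assms(3,5) this, of i k] show ?thesis
      by (simp add: s_def c_def w_def)
  qed
  have per: "s i p (k + int n) = s i p k" if "p \<in> ?P" for i p k
    using stationary_iterates_shift[OF stat[OF that] stat[OF that], of "int n" k]
    by (simp add: so_index_periodic s_def)
  have rot: "x (rotate1 p) k = x p (k + 1)" if "p \<in> ?P" for p k
  proof -
    have "rotate1 p \<in> ?P"
      using that by (simp add: permutations_of_set_def)
    with stationary_iterates_shift[OF stat[OF that] stat] that n show ?thesis
      by (simp add: so_index_rotate1 length_permutation)
  qed
  \<comment> \<open>Advancing time by one is the same as rotating the permutation, which only
    reorders the sum.\<close>
  have shift1: "(\<Sum>p\<in>?P. g (x p (k + 1))) = (\<Sum>p\<in>?P. g (x p k))" for g :: "real^'d \<Rightarrow> real" and k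
    using sum_permutations_rotate1[of "\<lambda>p. g (x p k)" "{1..n}"] by (simp add: rot)
  have shift: "(\<Sum>p\<in>?P. g (x p j)) = (\<Sum>p\<in>?P. g (x p k))" for g :: "real^'d \<Rightarrow> real" and j
  proof (induction j rule: int_induct[of _ k])
    case (step1 j)
    with shift1[of g j] show ?case by simp
  next
    case (step2 j)
    with shift1[of g "j - 1"] show ?case by simp
  qed simp
  \<comment> \<open>The fixed time is replaced by a whole period, on which the Fourier results
    apply.\<close>
  have avg: "(\<Sum>p\<in>?P. g (x p k)) = (\<Sum>p\<in>?P. \<Sum>j<n. g (x p (int j))) / real n"
    for g :: "real^'d \<Rightarrow> real"
  proof -
    have "(\<Sum>p\<in>?P. \<Sum>j<n. g (x p (int j))) = (\<Sum>j<n. \<Sum>p\<in>?P. g (x p (int j)))"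
      by (rule sum.swap)
    also have "\<dots> = (\<Sum>j<n. \<Sum>p\<in>?P. g (x p k))"
      by (intro sum.cong refl shift)
    finally show ?thesis
      using n by (simp add: field_simps)
  qed
  have w0: "(\<Sum>j=1..n. w i j) = 0" for i
    using sum_noise[OF n assms(3), of b] by (simp add: w_def flip: inner_sum_right)
  have w0': "(\<Sum>j<n. w i (so_index n p (int j))) = 0" if "p \<in> ?P" for i p
    using sum_nth_permutation[OF that, of "w i"] w0 by (simp add: so_index_nth)
  have zero: "(\<Sum>p\<in>?P. s i p k) = 0" for i
  proof -
    have "(\<Sum>j<n. s i p (int j)) = 0" if "p \<in> ?P" for p
      using sum_periodic_solution_eq_0[OF per[OF that] rec[OF that]] w0'[OF that] c_less[of i] by simp
    then show ?thesis
      using avg[of "\<lambda>y. u i \<bullet> (y - ?m)"] by (simp add: s_def)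
  qed
  \<comment> \<open>Every eigencoordinate of this vector vanishes, hence so does its norm: the
    expected iterate is the minimizer.\<close>
  have mean0: "(\<Sum>p\<in>?P. x p k - ?m) = 0"
  proof -
    have "u i \<bullet> (\<Sum>p\<in>?P. x p k - ?m) = 0" for i
      using zero[of i] by (simp add: s_def inner_sum_right)
    then show ?thesis
      using norm_square_orthonormal_basis[of u "\<Sum>p\<in>?P. x p k - ?m"] assms(4) by simp
  qed
  have square: "(\<Sum>p\<in>?P. (s i p k)\<^sup>2) =
      fact n * (\<gamma>\<^sup>2 / (real n - 1) * (mean n (\<lambda>j. (w i j)\<^sup>2) * G i))" for i
  proof -
    let ?W = "\<lambda>p m. (cmod (dft n (\<lambda>k. w i (so_index n p k)) m))\<^sup>2"
    let ?D = "\<lambda>m. (cmod (char_factor n (c i) \<alpha> m))\<^sup>2"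
    let ?V = "(real n)\<^sup>2 / (real n - 1) * (fact n * mean n (\<lambda>j. (w i j)\<^sup>2))"
    \<comment> \<open>The coefficient at frequency 0 is the sum of the noise over a full period;
      this is why the final sum starts at 1.\<close>
    have W0: "?W p 0 = 0" if "p \<in> ?P" for p
      using w0'[OF that, of i] by (simp add: dft_def flip: of_real_sum)
    have lt: "{..<n} = insert 0 {1..n - 1}"
      using n by auto
    have "(\<Sum>p\<in>?P. (s i p k)\<^sup>2) = (\<Sum>p\<in>?P. \<Sum>j<n. (s i p (int j))\<^sup>2) / real n"
      using avg[of "\<lambda>y. (u i \<bullet> (y - ?m))\<^sup>2"] by (simp add: s_def)
    also have "(\<Sum>p\<in>?P. \<Sum>j<n. (s i p (int j))\<^sup>2) = (\<Sum>p\<in>?P. \<gamma>\<^sup>2 / real n * (\<Sum>m<n. ?W p m / ?D m))"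
    proof (intro sum.cong refl)
      fix p assume p: "p \<in> ?P"
      show "(\<Sum>j<n. (s i p (int j))\<^sup>2) = \<gamma>\<^sup>2 / real n * (\<Sum>m<n. ?W p m / ?D m)"
        using sum_squares_periodic_solution[OF n per[OF p] rec[OF p] c_ge c_less assms(8,9)] .
    qed
    also have "\<dots> = \<gamma>\<^sup>2 / real n * (\<Sum>p\<in>?P. \<Sum>m<n. ?W p m / ?D m)"
      by (simp only: sum_distrib_left)
    also have "(\<Sum>p\<in>?P. \<Sum>m<n. ?W p m / ?D m) = (\<Sum>p\<in>?P. \<Sum>m=1..n - 1. ?W p m / ?D m)"
      using W0 unfolding lt by (intro sum.cong refl sum.mono_neutral_right) auto
    also have "\<dots> = (\<Sum>m=1..n - 1. \<Sum>p\<in>?P. ?W p m / ?D m)"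
      by (rule sum.swap)
    also have "\<dots> = (\<Sum>m=1..n - 1. ?V / ?D m)"
    proof (intro sum.cong refl)
      fix m assume "m \<in> {1..n - 1}"
      then have "0 < m" "m < n" by auto
      from sum_permutations_dft[OF this w0[of i]]
      show "(\<Sum>p\<in>?P. ?W p m / ?D m) = ?V / ?D m"
        by (simp only: sum_divide_distrib[symmetric])
    qed
    also have "\<dots> = ?V * G i"
      by (simp only: G_def sum_distrib_left divide_inverse)
    \<comment> \<open>The powers of \<open>n\<close> cancel: \<open>1 / n\<close> from averaging
      over time and \<open>1 / n\<close> from Parseval's identity against \<open>n^2\<close> in
      \<open>?V\<close>.\<close>
    finally show ?thesis
      using n by (simp add: power2_eq_square mult_ac)
  qed
  have "trace (covariance_matrix (measure_pmf (shuffle_once n)) (\<lambda>p. x p k)) =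
      (\<Sum>p\<in>?P. \<Sum>i\<in>UNIV. (s i p k)\<^sup>2) / fact n"
    unfolding trace_covariance_shuffle_once[OF mean0] norm_square_orthonormal_basis[OF assms(4)] s_def ..
  \<comment> \<open>Exchanging the sums allows the average over permutations to be taken separately
    in each eigendirection.\<close>
  also have "(\<Sum>p\<in>?P. \<Sum>i\<in>UNIV. (s i p k)\<^sup>2) = (\<Sum>i\<in>UNIV. \<Sum>p\<in>?P. (s i p k)\<^sup>2)"
    by (rule sum.swap)
  also have "\<dots> / fact n = \<gamma>\<^sup>2 / (real n - 1) * (\<Sum>i\<in>UNIV. mean n (\<lambda>j. (w i j)\<^sup>2) * G i)"
    unfolding square sum_distrib_left[symmetric] by simp
  finally show ?thesis
    by (simp add: inner_noise_cov w_def G_def norm_char_factor c_def power_int_minus)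
qed

end
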